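(* Consider the KL-penalized unbalanced optimal transport (UOT) problem with optimal dual solution $\hat{\boldsymbol\theta}$, and let $\underline{\boldsymbol\theta},\overline{\boldsymbol\theta}\in\mathbb{R}^{m+n}$ be the vectors of lower and upper bounds of $\hat{\boldsymbol\theta}$ obtained, as defined in the context, from a vector $\boldsymbol\theta^0\in\mathbb{R}^{m+n}$ and a primal variable $\boldsymbol t\in\mathbb{R}^{nm}_+$. Let $\mathcal R^B=\{\boldsymbol\theta\in\mathbb{R}^{m+n}:\underline\theta_i\le\theta_i\le\overline\theta_i\ \text{for all } i\}$. Then $\hat{\boldsymbol\theta}\in\mathcal R^B$; a point $\tilde{\boldsymbol\theta}\in\mathcal R^B\cap\mathcal R^D$ can be found (projecting on the box $\mathcal R^B$ being a coordinate-wise shifting); and the dual function $\mathbf D$ of the KL-penalized UOT problem is $(\mathcal R^B\cap\mathcal R^D)$-locally $\mathbf L$-blockwise strongly concave with $\mathbf L=\operatorname{Diag}(y_0e^{-\overline\theta_0},\dots,y_{m+n-1}e^{-\overline\theta_{m+n-1}})$.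
   Context: Let $m,n\ge1$, a weight $\lambda>0$, a cost vector $\boldsymbol c\in\mathbb{R}^{nm}_+$, a vector $\boldsymbol y\in\mathbb{R}^{m+n}$ with positive entries (the concatenation of the two given discrete measures), and the constant $\epsilon$ appearing in the KL penalty be given. Indices start at $0$. A transport matrix $\mathbf T$ with $m$ rows and $n$ columns and nonnegative entries is flattened row by row into $\boldsymbol t\in\mathbb{R}^{nm}_+$ ($t_{un+v}=T_{u,v}$), and the cost matrix into $\boldsymbol c$ likewise. The index matrix $\mathbf X\in\{0,1\}^{(m+n)\times nm}$ is such that $\mathbf X\boldsymbol t$ lists the $m$ row sums followed by the $n$ column sums of $\mathbf T$; its $p$-th column $\boldsymbol x_p$, $p=un+v$, has exactly two entries equal to $1$, at positions $u$ and $m+v$. The KL-penalized UOT problem is to minimize over $\boldsymbol t\in\mathbb{R}^{nm}_+$ the function $\lambda\boldsymbol c^T\boldsymbol t+\sum_i[((\mathbf X\boldsymbol t)_i+\epsilon)\ln\frac{(\mathbf X\boldsymbol t)_i+\epsilon}{y_i}-((\mathbf X\boldsymbol t)_i+\epsilon)+y_i]$. Its dual is to maximize $\mathbf D(\boldsymbol\theta)=\sum_{i=0}^{m+n-1}(-y_ie^{-\theta_i}+y_i-\epsilon\theta_i)$ over the dual feasible region $\mathcal R^D=\{\boldsymbol\theta\in\mathbb{R}^{m+n}:\boldsymbol x_p^T\boldsymbol\theta-\lambda c_p\le0\ \text{for all } 0\le p<nm\}$; the maximizer is $\hat{\boldsymbol\theta}$. Bounds: for each $j$ let $S_j=\{p:X_{j,p}=0\}$,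 $z_i=\sum_{p\in S_j}X_{i,p}t_p$, and $\mathbf P^j(\boldsymbol t)=\lambda\sum_{p\in S_j}c_pt_p+\sum_{i\ne j}[(z_i+\epsilon)\ln\frac{z_i+\epsilon}{y_i}-(z_i+\epsilon)+y_i]$ (the UOT problem with $y_j$ and everything attached to it deleted). Put $K^j=\mathbf D(\boldsymbol\theta^0)-\mathbf P^j(\boldsymbol t)$ and $\underline\theta_j=\ln\left(\frac{\epsilon-y_j}{K^j-y_j+\epsilon}\right)$ for $0\le j<m+n$. Put $\overline\theta_u=\min_{0\le v<n}(\lambda c_{un+v}-\underline\theta_{m+v})$ for $0\le u<m$, and $\overline\theta_{m+v}=\min_{0\le u<m}(\lambda c_{un+v}-\underline\theta_u)$ for $0\le v<n$. A differentiable function $f$ is $\mathcal G$-locally $\mathbf L$-blockwise strongly concave, for a set $\mathcal G$ and a diagonal positive-definite matrix $\mathbf L$, if $f(\boldsymbol w)\le f(\boldsymbol x)+\nabla f(\boldsymbol x)^T(\boldsymbol w-\boldsymbol x)-\frac12(\boldsymbol w-\boldsymbol x)^T\mathbf L(\boldsymbol w-\boldsymbol x)$ for all $\boldsymbol x,\boldsymbol w\in\mathcal G$.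
   Formalization: The vector θ^0 is additionally assumed dual feasible (in R^D), and ε is assumed to satisfy 0 ≤ ε < y_j for all j; without these the lower-bound formula can be undefined or exceed the optimal dual solution, so the claim fails. *)

theory Defs
  imports "HOL-Analysis.Analysis"
begin

text \<open>
  The finite types \<open>'m\<close> and \<open>'n\<close> index the rows and the columns of the transport matrix, so
  \<open>m = CARD('m)\<close> and \<open>n = CARD('n)\<close> are at least 1. The positions \<open>0, ..., m + n - 1\<close> are the
  elements of \<open>'m + 'n\<close>: \<open>Inl u\<close> is position \<open>u\<close> and \<open>Inr v\<close> is position \<open>m + v\<close>. The position
  \<open>p = u n + v\<close> of a flattened matrix is the pair \<open>(u, v)\<close>.
\<close>

definition uot_X :: "real ^ ('m::finite \<times> 'n::finite) ^ ('m + 'n)" where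
  "uot_X = (\<chi> i p. if i = Inl (fst p) \<or> i = Inr (snd p) then 1 else 0)"

lemma uot_X_row_sum:
  fixes t :: "real ^ ('m::finite \<times> 'n::finite)"
  shows "(uot_X *v t) $ Inl u = (\<Sum>v\<in>UNIV. t $ (u, v))"
proof -
  have "(uot_X *v t) $ Inl u = (\<Sum>p\<in>UNIV. if fst p = u then t $ p else 0)"
    by (auto simp: uot_X_def matrix_vector_mult_def intro!: sum.cong)
  also have "\<dots> = (\<Sum>a\<in>UNIV. \<Sum>v\<in>UNIV. if a = u then t $ (a, v) else 0)"
    by (subst sum.cartesian_product) (auto simp: UNIV_Times_UNIV intro!: sum.cong)
  also have "\<dots> = (\<Sum>v\<in>UNIV. t $ (u, v))"
    by (subst sum.swap) simp
  finally show ?thesis .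
qed

lemma uot_X_column_sum:
  fixes t :: "real ^ ('m::finite \<times> 'n::finite)"
  shows "(uot_X *v t) $ Inr v = (\<Sum>u\<in>UNIV. t $ (u, v))"
proof -
  have "(uot_X *v t) $ Inr v = (\<Sum>p\<in>UNIV. if snd p = v then t $ p else 0)"
    by (auto simp: uot_X_def matrix_vector_mult_def intro!: sum.cong)
  also have "\<dots> = (\<Sum>u\<in>UNIV. \<Sum>b\<in>UNIV. if b = v then t $ (u, b) else 0)"
    by (subst sum.cartesian_product) (auto simp: UNIV_Times_UNIV intro!: sum.cong)
  also have "\<dots> = (\<Sum>u\<in>UNIV. t $ (u, v))"
    by simp
  finally show ?thesis .
qed

text \<open>For \<open>s + \<epsilon> = 0\<close> this uses \<open>0 * ln 0 = 0\<close>, which holds for the library's total \<open>ln\<close>.\<close>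

definition kl_penalty :: "real \<Rightarrow> real \<Rightarrow> real \<Rightarrow> real" where
  "kl_penalty \<epsilon> b s = (s + \<epsilon>) * ln ((s + \<epsilon>) / b) - (s + \<epsilon>) + b"

definition uot_primal ::
  "real \<Rightarrow> real \<Rightarrow> real ^ ('m::finite \<times> 'n::finite) \<Rightarrow> real ^ ('m + 'n)
    \<Rightarrow> real ^ ('m \<times> 'n) \<Rightarrow> real" where
  "uot_primal lam \<epsilon> c y t =
     lam * (c \<bullet> t) + (\<Sum>i\<in>UNIV. kl_penalty \<epsilon> (y $ i) ((uot_X *v t) $ i))"

definition uot_dual :: "real \<Rightarrow> real ^ ('m::finite + 'n::finite) \<Rightarrow> real ^ ('m + 'n) \<Rightarrow> real" where
  "uot_dual \<epsilon> y \<theta> = (\<Sum>i\<in>UNIV. - (y $ i) * exp (- (\<theta> $ i)) + y $ i - \<epsilon> * \<theta> $ i)"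

definition uot_dual_region ::
  "real \<Rightarrow> real ^ ('m::finite \<times> 'n::finite) \<Rightarrow> (real ^ ('m + 'n)) set" where
  "uot_dual_region lam c = {\<theta>. \<forall>p. column p uot_X \<bullet> \<theta> - lam * c $ p \<le> 0}"

definition uot_reduced_primal ::
  "real \<Rightarrow> real \<Rightarrow> real ^ ('m::finite \<times> 'n::finite) \<Rightarrow> real ^ ('m + 'n) \<Rightarrow> 'm + 'n
    \<Rightarrow> real ^ ('m \<times> 'n) \<Rightarrow> real" where
  "uot_reduced_primal lam \<epsilon> c y j t =
     (let S = {p. (uot_X :: real ^ ('m \<times> 'n) ^ ('m + 'n)) $ j $ p = 0};
          z = (\<lambda>i. \<Sum>p\<in>S. uot_X $ i $ p * t $ p)
      in lam * (\<Sum>p\<in>S. c $ p * t $ p) + (\<Sum>i\<in>UNIV - {j}. kl_penalty \<epsilon> (y $ i) (z i)))"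

definition uot_lower ::
  "real \<Rightarrow> real \<Rightarrow> real ^ ('m::finite \<times> 'n::finite) \<Rightarrow> real ^ ('m + 'n)
    \<Rightarrow> real ^ ('m + 'n) \<Rightarrow> real ^ ('m \<times> 'n) \<Rightarrow> real ^ ('m + 'n)" where
  "uot_lower lam \<epsilon> c y \<theta>0 t =
     (\<chi> j. let K = uot_dual \<epsilon> y \<theta>0 - uot_reduced_primal lam \<epsilon> c y j t
           in ln ((\<epsilon> - y $ j) / (K - y $ j + \<epsilon>)))"

definition uot_upper ::
  "real \<Rightarrow> real ^ ('m::finite \<times> 'n::finite) \<Rightarrow> real ^ ('m + 'n) \<Rightarrow> real ^ ('m + 'n)" where
  "uot_upper lam c lo =
     (\<chi> i. case i of
         Inl u \<Rightarrow> (MIN v\<in>UNIV. lam * c $ (u, v) - lo $ Inr v)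
       | Inr v \<Rightarrow> (MIN u\<in>UNIV. lam * c $ (u, v) - lo $ Inl u))"

definition uot_box ::
  "real ^ ('m::finite + 'n::finite) \<Rightarrow> real ^ ('m + 'n) \<Rightarrow> (real ^ ('m + 'n)) set" where
  "uot_box lo hi = {\<theta>. \<forall>i. lo $ i \<le> \<theta> $ i \<and> \<theta> $ i \<le> hi $ i}"

definition Diag :: "real ^ 'k \<Rightarrow> real ^ 'k ^ 'k" where
  "Diag d = (\<chi> i j. if i = j then d $ i else 0)"

definition locally_blockwise_strongly_concave ::
  "(real ^ 'k::finite) set \<Rightarrow> real ^ 'k ^ 'k \<Rightarrow> (real ^ 'k \<Rightarrow> real) \<Rightarrow> bool" where
  "locally_blockwise_strongly_concave G L f \<longleftrightarrow>
     (\<forall>i j. i \<noteq> j \<longrightarrow> L $ i $ j = 0) \<and>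
     (\<forall>h. h \<noteq> 0 \<longrightarrow> 0 < h \<bullet> (L *v h)) \<and>
     (\<exists>grad. (\<forall>x. GDERIV f x :> grad x) \<and>
        (\<forall>x\<in>G. \<forall>w\<in>G.
           f w \<le> f x + grad x \<bullet> (w - x) - 1 / 2 * ((w - x) \<bullet> (L *v (w - x)))))"

end

theory Submission
  imports Defs
begin

text \<open>
  The dual objective is a sum of the concave functions
  \<open>d\<^sub>i(s) = - y\<^sub>i exp (- s) + y\<^sub>i - \<epsilon> s\<close>, one per coordinate, and the dual region only couples
  a row with a column: it says \<open>\<theta>\<^sub>u + \<theta>\<^sub>v \<le> \<lambda> c\<^sub>u\<^sub>v\<close>.

  Lower bound. Deleting one marginal \<open>j\<close> leaves a smaller transport problem, and Fenchel--Young
  gives weak duality for it: every dual feasible \<open>\<theta>\<close> satisfies \<open>(\<Sum>i\<noteq>j. d\<^sub>i(\<theta>\<^sub>i)) \<le> P\<^sup>j(t)\<close>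
  (lemma \<open>reduced_weak_duality\<close>). If \<open>\<theta>\<close> is at least as good as \<open>\<theta>\<^sup>0\<close>, subtraction yields
  \<open>K\<^sup>j \<le> d\<^sub>j(\<theta>\<^sub>j)\<close>, a bound on a single coordinate. Replacing the linear term by
  \<open>- \<theta>\<^sub>j \<le> exp (- \<theta>\<^sub>j) - 1\<close> makes it solvable for \<open>\<theta>\<^sub>j\<close> in closed form, which is exactly
  the lower bound (lemma \<open>lower_bound\<close>). The pairwise constraints turn lower bounds of the
  columns into upper bounds of the rows and conversely, so the optimum lies in the box.

  Projection. The nearest point of a box is found by clipping each coordinate. Clipping preserves
  dual feasibility: a coordinate grows only by being moved up to its lower bound, and by
  construction the upper bound of any partner coordinate leaves room for precisely that.

  Strong concavity. The Hessian of the dual is \<open>- Diag (y\<^sub>i exp (- \<theta>\<^sub>i))\<close>, and on the box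
  \<open>exp (- \<theta>\<^sub>i)\<close> is at least its value at the upper bound; a second-order Taylor expansion
  in each coordinate gives the inequality.
\<close>

section \<open>Pairwise form of the dual constraints\<close>

text \<open>Column \<open>(u, v)\<close> of the index matrix is the sum of two unit vectors.\<close>

lemma mem_uot_dual_region_iff:
  fixes \<theta> :: "real ^ ('m::finite + 'n::finite)"
  shows "\<theta> \<in> uot_dual_region lam c \<longleftrightarrow>
    (\<forall>u v. \<theta> $ Inl u + \<theta> $ Inr v \<le> lam * c $ (u, v))"
proof -
  have "column p uot_X \<bullet> \<theta> = \<theta> $ Inl (fst p) + \<theta> $ Inr (snd p)" for p :: "'m \<times> 'n"
  proof -
    have "column p uot_X \<bullet> \<theta> =
        (\<Sum>i\<in>UNIV. (if i = Inl (fst p) then \<theta> $ i else 0) +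
                    (if i = Inr (snd p) then \<theta> $ i else 0))"
      by (auto simp: column_def uot_X_def inner_vec_def intro!: sum.cong)
    then show ?thesis
      by (simp add: sum.distrib)
  qed
  then show ?thesis
    by (simp add: uot_dual_region_def)
qed

section \<open>Lower bounds from weak duality\<close>

text \<open>
  The convex conjugate of the penalty, evaluated at \<open>- x\<close>, is \<open>b exp (- x) - b + \<epsilon> x\<close>; this is
  its Fenchel--Young inequality. With \<open>a = s + \<epsilon>\<close> and \<open>q = b exp (- x)\<close> it reads
  \<open>a ln (a / q) - a + q \<ge> 0\<close>, which for \<open>a > 0\<close> is \<open>ln z \<le> z - 1\<close> at \<open>z = q / a\<close>.
\<close>

lemma kl_penalty_young:
  assumes "0 < b" and "0 \<le> s + \<epsilon>"
  shows "- b * exp (- x) + b - \<epsilon> * x - s * x \<le> kl_penalty \<epsilon> b s"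
proof (cases "s + \<epsilon> = 0")
  case True
  then have "\<epsilon> * x + s * x = 0"
    by (metis add.commute distrib_right mult_zero_left)
  moreover have "0 < b * exp (- x)"
    using assms by simp
  moreover have "kl_penalty \<epsilon> b s = b"
    using True by (simp add: kl_penalty_def)
  ultimately show ?thesis
    by simp
next
  case False
  define a where "a = s + \<epsilon>"
  have a: "0 < a"
    using False assms by (simp add: a_def)
  have "ln (b * exp (- x) / a) \<le> b * exp (- x) / a - 1"
    using a assms by (intro ln_le_minus_one) simp
  moreover have "ln (b * exp (- x) / a) = - ln (a / b) - x"
    using a assms by (simp add: ln_div ln_mult)
  ultimately have "a * (- ln (a / b) - x) \<le> a * (b * exp (- x) / a - 1)"
    using a by (intro mult_left_mono) auto
  also have "\<dots> = b * exp (- x) - a"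
    using a by (simp add: field_simps)
  finally have "a * (- ln (a / b) - x) \<le> b * exp (- x) - a" .
  moreover have "\<epsilon> * x + s * x = a * x"
    by (simp add: a_def algebra_simps)
  moreover have "kl_penalty \<epsilon> b s = a * ln (a / b) - a + b"
    by (simp add: kl_penalty_def a_def)
  ultimately show ?thesis
    by (simp add: algebra_simps)
qed

text \<open>
  Weak duality without marginal \<open>j\<close>. The terms \<open>z\<^sub>i \<theta>\<^sub>i\<close> left over by Fenchel--Young add up to
  \<open>\<Sum>p\<in>S. t\<^sub>p (x\<^sub>p \<bullet> \<theta>)\<close>, because no column indexed by \<open>S\<close> has an entry at \<open>j\<close>; feasibility
  bounds this by the transport cost.
\<close>

lemma reduced_weak_duality:
  fixes \<theta> :: "real ^ ('m::finite + 'n::finite)"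
  assumes feas: "\<theta> \<in> uot_dual_region lam c"
    and y: "\<forall>i. 0 < y $ i" and eps: "0 \<le> \<epsilon>" and t: "\<forall>p. 0 \<le> t $ p"
  shows "(\<Sum>i\<in>UNIV - {j}. - (y $ i) * exp (- (\<theta> $ i)) + y $ i - \<epsilon> * \<theta> $ i)
    \<le> uot_reduced_primal lam \<epsilon> c y j t"
proof -
  define S where "S = {p. (uot_X :: real ^ ('m \<times> 'n) ^ ('m + 'n)) $ j $ p = 0}"
  define z where "z i = (\<Sum>p\<in>S. uot_X $ i $ p * t $ p)" for i :: "'m + 'n"
  have z: "0 \<le> z i" for i
    unfolding z_def using t by (intro sum_nonneg mult_nonneg_nonneg) (auto simp: uot_X_def)
  have "z j = 0"
    unfolding z_def S_def by (intro sum.neutral) auto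
  then have "(\<Sum>i\<in>UNIV - {j}. z i * \<theta> $ i) = (\<Sum>i\<in>UNIV. z i * \<theta> $ i)"
    by (intro sum.mono_neutral_left) auto
  also have "\<dots> = (\<Sum>p\<in>S. t $ p * (column p uot_X \<bullet> \<theta>))"
    unfolding z_def sum_distrib_right
    by (subst sum.swap)
       (simp add: column_def inner_vec_def sum_distrib_left algebra_simps)
  also have "\<dots> \<le> (\<Sum>p\<in>S. t $ p * (lam * c $ p))"
    using feas t by (intro sum_mono mult_left_mono) (auto simp: uot_dual_region_def)
  also have "\<dots> = lam * (\<Sum>p\<in>S. c $ p * t $ p)"
    by (simp add: sum_distrib_left algebra_simps)
  finally have cost: "(\<Sum>i\<in>UNIV - {j}. z i * \<theta> $ i) \<le> lam * (\<Sum>p\<in>S. c $ p * t $ p)" .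
  have "(\<Sum>i\<in>UNIV - {j}. - (y $ i) * exp (- (\<theta> $ i)) + y $ i - \<epsilon> * \<theta> $ i - z i * \<theta> $ i)
      \<le> (\<Sum>i\<in>UNIV - {j}. kl_penalty \<epsilon> (y $ i) (z i))"
    using y eps z by (intro sum_mono kl_penalty_young) auto
  with cost show ?thesis
    unfolding uot_reduced_primal_def Let_def S_def[symmetric] z_def[symmetric]
    by (simp add: sum_subtractf)
qed

text \<open>
  Since \<open>- x \<le> exp (- x) - 1\<close>, the last hypothesis implies \<open>K \<le> (b - \<epsilon>) (1 - exp (- x))\<close>. This also
  shows that the argument of the logarithm, a quotient of two negative numbers, is positive.
\<close>

lemma dual_term_lower_bound:
  fixes b \<epsilon> K x :: real
  assumes "0 \<le> \<epsilon>" and "\<epsilon> < b" and "K \<le> - b * exp (- x) + b - \<epsilon> * x"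
  shows "ln ((\<epsilon> - b) / (K - b + \<epsilon>)) \<le> x"
proof -
  have "\<epsilon> * (1 + (- x)) \<le> \<epsilon> * exp (- x)"
    using assms by (intro mult_left_mono exp_ge_add_one_self) auto
  with assms have *: "(b - \<epsilon>) * exp (- x) \<le> b - \<epsilon> - K"
    by (simp add: algebra_simps)
  have "0 < (b - \<epsilon>) * exp (- x)"
    using assms by simp
  with * have pos: "0 < b - \<epsilon> - K"
    by linarith
  have "(b - \<epsilon>) / (b - \<epsilon> - K) \<le> exp x"
    using * pos by (simp add: exp_minus field_simps)
  moreover have "0 < (b - \<epsilon>) / (b - \<epsilon> - K)"
    using assms pos by simp
  ultimately have "ln ((b - \<epsilon>) / (b - \<epsilon> - K)) \<le> x"
    using ln_le_cancel_iff[of "(b - \<epsilon>) / (b - \<epsilon> - K)" "exp x"] by simp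
  moreover have "(\<epsilon> - b) / (K - b + \<epsilon>) = (b - \<epsilon>) / (b - \<epsilon> - K)"
    by (subst minus_divide_divide[symmetric]) (simp add: algebra_simps)
  ultimately show ?thesis
    by simp
qed

text \<open>
  Only the objective value of \<open>\<theta>\<close> relative to the reference point \<open>\<theta>\<^sup>0\<close> matters, so the bound
  holds on a whole superlevel set of the dual and not just at its maximizer.
\<close>

lemma lower_bound:
  fixes \<theta> :: "real ^ ('m::finite + 'n::finite)"
  assumes feas: "\<theta> \<in> uot_dual_region lam c"
    and better: "uot_dual \<epsilon> y \<theta>0 \<le> uot_dual \<epsilon> y \<theta>"
    and y: "\<forall>i. 0 < y $ i" and eps: "0 \<le> \<epsilon>" and eps_y: "\<forall>i. \<epsilon> < y $ i"
    and t: "\<forall>p. 0 \<le> t $ p"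
  shows "uot_lower lam \<epsilon> c y \<theta>0 t $ j \<le> \<theta> $ j"
proof -
  have "uot_dual \<epsilon> y \<theta> = (- (y $ j) * exp (- (\<theta> $ j)) + y $ j - \<epsilon> * \<theta> $ j) +
      (\<Sum>i\<in>UNIV - {j}. - (y $ i) * exp (- (\<theta> $ i)) + y $ i - \<epsilon> * \<theta> $ i)"
    unfolding uot_dual_def by (rule sum.remove) auto
  then have "uot_dual \<epsilon> y \<theta>0 - uot_reduced_primal lam \<epsilon> c y j t
      \<le> - (y $ j) * exp (- (\<theta> $ j)) + y $ j - \<epsilon> * \<theta> $ j"
    using reduced_weak_duality[OF feas y eps t, of j] better by linarith
  then show ?thesis
    using eps eps_y by (simp add: uot_lower_def Let_def dual_term_lower_bound)
qed

section \<open>The box of bounds and its projection\<close>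

lemma uot_upper_constraint:
  "uot_upper lam c lo $ Inl u + lo $ Inr v \<le> lam * c $ (u, v)"
  "lo $ Inl u + uot_upper lam c lo $ Inr v \<le> lam * c $ (u, v)"
proof -
  have "(MIN v\<in>UNIV. lam * c $ (u, v) - lo $ Inr v) \<le> lam * c $ (u, v) - lo $ Inr v"
    by (rule Min_le) auto
  moreover have "uot_upper lam c lo $ Inl u = (MIN v\<in>UNIV. lam * c $ (u, v) - lo $ Inr v)"
    by (simp add: uot_upper_def)
  ultimately show "uot_upper lam c lo $ Inl u + lo $ Inr v \<le> lam * c $ (u, v)"
    by linarith
  have "(MIN u\<in>UNIV. lam * c $ (u, v) - lo $ Inl u) \<le> lam * c $ (u, v) - lo $ Inl u"
    by (rule Min_le) auto
  moreover have "uot_upper lam c lo $ Inr v = (MIN u\<in>UNIV. lam * c $ (u, v) - lo $ Inl u)"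
    by (simp add: uot_upper_def)
  ultimately show "lo $ Inl u + uot_upper lam c lo $ Inr v \<le> lam * c $ (u, v)"
    by linarith
qed

text \<open>
  By feasibility \<open>\<theta>\<^sub>u \<le> \<lambda> c\<^sub>u\<^sub>v - \<theta>\<^sub>v \<le> \<lambda> c\<^sub>u\<^sub>v - lo\<^sub>v\<close> for all \<open>v\<close>, and symmetrically for columns.
\<close>

lemma upper_bound:
  fixes \<theta> :: "real ^ ('m::finite + 'n::finite)"
  assumes feas: "\<theta> \<in> uot_dual_region lam c" and lo: "\<And>i. lo $ i \<le> \<theta> $ i"
  shows "\<theta> $ i \<le> uot_upper lam c lo $ i"
proof -
  have pair: "\<theta> $ Inl u + \<theta> $ Inr v \<le> lam * c $ (u, v)" for u v
    using feas by (simp add: mem_uot_dual_region_iff)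
  have "\<theta> $ Inl u \<le> lam * c $ (u, v) - lo $ Inr v" for u v
    using pair[of u v] lo[of "Inr v"] by linarith
  moreover have "\<theta> $ Inr v \<le> lam * c $ (u, v) - lo $ Inl u" for u v
    using pair[of u v] lo[of "Inl u"] by linarith
  ultimately show ?thesis
    by (cases i) (auto simp: uot_upper_def)
qed

text \<open>
  Clipping is optimal in each coordinate separately, and the Euclidean norm is monotone in the
  absolute values of the coordinates.
\<close>

lemma closest_point_uot_box:
  fixes lo hi \<theta> :: "real ^ ('m::finite + 'n::finite)"
  assumes le: "\<And>i. lo $ i \<le> hi $ i"
  shows "closest_point (uot_box lo hi) \<theta> = (\<chi> i. max (lo $ i) (min (hi $ i) (\<theta> $ i)))"
    (is "_ = ?x")
proof -
  have box: "uot_box lo hi = cbox lo hi"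
    by (auto simp: uot_box_def mem_box_cart)
  have "dist \<theta> ?x \<le> dist \<theta> z" if "z \<in> uot_box lo hi" for z
    unfolding dist_norm
  proof (rule norm_le_componentwise_cart)
    fix i
    have "lo $ i \<le> z $ i" "z $ i \<le> hi $ i"
      using that by (auto simp: uot_box_def)
    then show "norm ((\<theta> - ?x) $ i) \<le> norm ((\<theta> - z) $ i)"
      by (auto simp: max_def min_def)
  qed
  moreover have "?x \<in> uot_box lo hi"
    using le by (auto simp: uot_box_def)
  ultimately show ?thesis
    by (intro closest_point_unique[symmetric]) (auto simp: box)
qed

text \<open>
  If clipping does not increase either coordinate of a pair, the constraint persists; if it
  increases one, that coordinate becomes its lower bound, and the other one is at most its upper
  bound.
\<close>

lemma clip_feasible:
  fixes lam :: real and c :: "real ^ ('m::finite \<times> 'n::finite)"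
    and \<theta> lo :: "real ^ ('m + 'n)"
  defines "hi \<equiv> uot_upper lam c lo"
  assumes feas: "\<theta> \<in> uot_dual_region lam c" and le: "\<And>i. lo $ i \<le> hi $ i"
  shows "(\<chi> i. max (lo $ i) (min (hi $ i) (\<theta> $ i))) \<in> uot_dual_region lam c"
proof -
  have "max (lo $ Inl u) (min (hi $ Inl u) (\<theta> $ Inl u)) +
      max (lo $ Inr v) (min (hi $ Inr v) (\<theta> $ Inr v)) \<le> lam * c $ (u, v)" for u v
  proof -
    have "\<theta> $ Inl u + \<theta> $ Inr v \<le> lam * c $ (u, v)"
      using feas by (simp add: mem_uot_dual_region_iff)
    then show ?thesis
      using uot_upper_constraint[where lam = lam and c = c and lo = lo and u = u and v = v] le[of "Inl u"] le[of "Inr v"]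
      unfolding hi_def[symmetric] by (auto simp: max_def min_def)
  qed
  then show ?thesis
    by (simp add: mem_uot_dual_region_iff)
qed

section \<open>Strong concavity\<close>

text \<open>
  The second-order remainder is \<open>exp (- s) (w - x)\<^sup>2 / 2\<close> for some \<open>s\<close> between \<open>x\<close> and \<open>w\<close>,
  hence below \<open>h\<close>.
\<close>

lemma exp_minus_quadratic_lower_bound:
  fixes x w h :: real
  assumes "x \<le> h" and "w \<le> h"
  shows "exp (- x) - exp (- x) * (w - x) + exp (- h) * (w - x)\<^sup>2 / 2 \<le> exp (- w)"
proof (cases "w = x")
  case False
  define D where "D k s = (- 1) ^ k * exp (- s)" for k and s :: real
  have D: "DERIV (D k) s :> D (Suc k) s" for k s
    unfolding D_def by (auto intro!: derivative_eq_intros)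
  obtain s where s: "if w < x then w < s \<and> s < x else x < s \<and> s < w"
    and eq: "exp (- w) = (\<Sum>k<2. D k x / fact k * (w - x) ^ k) + D 2 s / fact 2 * (w - x) ^ 2"
    using Taylor[of 2 D "\<lambda>s. exp (- s)" "min x w" "max x w" x w] D False
    by (auto simp: D_def fun_eq_iff)
  have "exp (- h) \<le> exp (- s)"
    using s assms by (auto split: if_splits)
  then have "exp (- h) * (w - x)\<^sup>2 \<le> exp (- s) * (w - x)\<^sup>2"
    by (intro mult_right_mono) auto
  then show ?thesis
    unfolding eq by (simp add: D_def numeral_2_eq_2)
qed simp

lemma Diag_mult_vec: "Diag d *v h = (\<chi> i. d $ i * h $ i)"
  by (simp add: Diag_def matrix_vector_mult_def vec_eq_iff if_distrib[of "\<lambda>a. a * _"] cong: if_cong)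

lemma uot_dual_gderiv:
  fixes \<theta> :: "real ^ ('m::finite + 'n::finite)"
  shows "GDERIV (uot_dual \<epsilon> y) \<theta> :> (\<chi> i. y $ i * exp (- (\<theta> $ i)) - \<epsilon>)"
proof -
  have "((\<lambda>\<theta>. \<Sum>i\<in>UNIV. - (y $ i) * exp (- (\<theta> $ i)) + y $ i - \<epsilon> * \<theta> $ i) has_derivative
      (\<lambda>h. \<Sum>i\<in>UNIV. h $ i * (y $ i * exp (- (\<theta> $ i)) - \<epsilon>))) (at \<theta>)"
    by (auto intro!: derivative_eq_intros has_derivative_sum
        bounded_linear_imp_has_derivative[OF bounded_linear_vec_nth] simp: algebra_simps)
  then show ?thesis
    by (simp add: gderiv_def inner_vec_def uot_dual_def[abs_def])
qed

lemma uot_dual_strongly_concave: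
  fixes hi :: "real ^ ('m::finite + 'n::finite)"
  assumes y: "\<forall>i. 0 < y $ i" and G: "\<And>x i. x \<in> G \<Longrightarrow> x $ i \<le> hi $ i"
  shows "locally_blockwise_strongly_concave G
    (Diag (\<chi> i. y $ i * exp (- (hi $ i)))) (uot_dual \<epsilon> y)"
  unfolding locally_blockwise_strongly_concave_def
proof (intro conjI allI impI exI ballI)
  let ?L = "Diag (\<chi> i. y $ i * exp (- (hi $ i)))"
  show "?L $ i $ j = 0" if "i \<noteq> j" for i j
    using that by (simp add: Diag_def)
  show "0 < h \<bullet> (?L *v h)" if "h \<noteq> 0" for h
  proof -
    obtain k where k: "h $ k \<noteq> 0"
      using \<open>h \<noteq> 0\<close> by (auto simp: vec_eq_iff)
    have "h \<bullet> (?L *v h) = (\<Sum>i\<in>UNIV. y $ i * exp (- (hi $ i)) * (h $ i)\<^sup>2)"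
      by (simp add: Diag_mult_vec inner_vec_def power2_eq_square algebra_simps)
    also have "\<dots> > 0"
      using y k by (intro sum_pos2[of _ k]) (auto simp: less_imp_le)
    finally show ?thesis .
  qed
  show "GDERIV (uot_dual \<epsilon> y) x :> (\<chi> i. y $ i * exp (- (x $ i)) - \<epsilon>)" for x
    by (rule uot_dual_gderiv)
  show "uot_dual \<epsilon> y w \<le> uot_dual \<epsilon> y x + (\<chi> i. y $ i * exp (- (x $ i)) - \<epsilon>) \<bullet> (w - x)
      - 1 / 2 * ((w - x) \<bullet> (?L *v (w - x)))"
    if "x \<in> G" and "w \<in> G" for x w
  proof -
    have "- (y $ i) * exp (- (w $ i)) + y $ i - \<epsilon> * w $ i
        \<le> (- (y $ i) * exp (- (x $ i)) + y $ i - \<epsilon> * x $ i)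
          + (y $ i * exp (- (x $ i)) - \<epsilon>) * (w $ i - x $ i)
          - 1 / 2 * ((w $ i - x $ i) * (y $ i * exp (- (hi $ i)) * (w $ i - x $ i)))" for i
    proof -
      have "y $ i * (exp (- (x $ i)) - exp (- (x $ i)) * (w $ i - x $ i)
            + exp (- (hi $ i)) * (w $ i - x $ i)\<^sup>2 / 2) \<le> y $ i * exp (- (w $ i))"
        using y that G
        by (intro mult_left_mono exp_minus_quadratic_lower_bound) (auto simp: less_imp_le)
      then show ?thesis
        by (simp add: field_simps power2_eq_square)
    qed
    then have "uot_dual \<epsilon> y w \<le> (\<Sum>i\<in>UNIV. (- (y $ i) * exp (- (x $ i)) + y $ i - \<epsilon> * x $ i)
          + (y $ i * exp (- (x $ i)) - \<epsilon>) * (w $ i - x $ i)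
          - 1 / 2 * ((w $ i - x $ i) * (y $ i * exp (- (hi $ i)) * (w $ i - x $ i))))"
      unfolding uot_dual_def by (rule sum_mono)
    also have "\<dots> = uot_dual \<epsilon> y x + (\<chi> i. y $ i * exp (- (x $ i)) - \<epsilon>) \<bullet> (w - x)
        - 1 / 2 * ((w - x) \<bullet> (?L *v (w - x)))"
      unfolding uot_dual_def Diag_mult_vec inner_vec_def sum_subtractf sum.distrib sum_distrib_left
      by simp
    finally show ?thesis .
  qed
qed

section \<open>Bounds, projection and strong concavity together\<close>

theorem mainTheorem6:
  fixes lam \<epsilon> :: real
    and c t :: "real ^ ('m::finite \<times> 'n::finite)"
    and y \<theta>0 \<theta>hat :: "real ^ ('m + 'n)"
  assumes "0 < lam"
    and "\<forall>p. 0 \<le> c $ p"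
    and "\<forall>i. 0 < y $ i"
    and "0 \<le> \<epsilon>"
    and "\<forall>i. \<epsilon> < y $ i"
    and "is_arg_max (uot_dual \<epsilon> y) (\<lambda>\<theta>. \<theta> \<in> uot_dual_region lam c) \<theta>hat"
    and "\<theta>0 \<in> uot_dual_region lam c"
    and "\<forall>p. 0 \<le> t $ p"
  shows "let lo = uot_lower lam \<epsilon> c y \<theta>0 t;
             hi = uot_upper lam c lo;
             RB = uot_box lo hi;
             RD = uot_dual_region lam c
         in \<theta>hat \<in> RB
          \<and> (\<exists>\<theta>'. \<theta>' \<in> RB \<inter> RD)
          \<and> (\<forall>\<theta>. closest_point RB \<theta> = (\<chi> i. max (lo $ i) (min (hi $ i) (\<theta> $ i))))
          \<and> (\<forall>\<theta>\<in>RD. closest_point RB \<theta> \<in> RB \<inter> RD)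
          \<and> locally_blockwise_strongly_concave (RB \<inter> RD)
              (Diag (\<chi> i. y $ i * exp (- (hi $ i)))) (uot_dual \<epsilon> y)"
proof -
  define lo where "lo = uot_lower lam \<epsilon> c y \<theta>0 t"
  define hi where "hi = uot_upper lam c lo"
  define RB where "RB = uot_box lo hi"
  define RD where "RD = uot_dual_region lam c"
  have feas: "\<theta>hat \<in> RD" and best: "uot_dual \<epsilon> y \<theta>0 \<le> uot_dual \<epsilon> y \<theta>hat"
    using assms(6,7) by (auto simp: is_arg_max_linorder RD_def)
  have lo: "lo $ i \<le> \<theta>hat $ i" for i
    unfolding lo_def using feas best assms unfolding RD_def by (intro lower_bound) auto
  have hi: "\<theta>hat $ i \<le> hi $ i" for i
    unfolding hi_def using feas lo unfolding RD_def by (rule upper_bound)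
  have le: "lo $ i \<le> hi $ i" for i
    using lo[of i] hi[of i] by linarith
  have mem: "\<theta>hat \<in> RB"
    using lo hi by (simp add: RB_def uot_box_def)
  have proj: "closest_point RB \<theta> = (\<chi> i. max (lo $ i) (min (hi $ i) (\<theta> $ i)))" for \<theta>
    unfolding RB_def using le by (rule closest_point_uot_box)
  have "closest_point RB \<theta> \<in> RB \<inter> RD" if "\<theta> \<in> RD" for \<theta>
  proof
    show "closest_point RB \<theta> \<in> RB"
      unfolding proj using le by (auto simp: RB_def uot_box_def)
    show "closest_point RB \<theta> \<in> RD"
      using that le unfolding proj RD_def hi_def by (rule clip_feasible)
  qed
  moreover have "locally_blockwise_strongly_concave (RB \<inter> RD)
      (Diag (\<chi> i. y $ i * exp (- (hi $ i)))) (uot_dual \<epsilon> y)"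
    using assms(3) by (rule uot_dual_strongly_concave) (auto simp: RB_def uot_box_def)
  ultimately show ?thesis
    unfolding Let_def lo_def[symmetric] hi_def[symmetric] RB_def[symmetric] RD_def[symmetric]
    using mem feas proj by blast
qed

end
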